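(* Let $E$ be an infinite graph that contains a finite attractor subgraph, and let $(X,\sigma)$ be the associated Deaconu-Renault system. Then $(X,\sigma)$ has the shadowing property if, and only if, $E$ satisfies the eventually constrained immediate follower set property.
   Context: $\mathbb N=\{1,2,\ldots\}$. Graphs. A graph is $E=(E^0,E^1,r,s)$ with $E^0,E^1$ countable and $r,s:E^1\to E^0$; all graphs $E$ whose system is considered are assumed to have no sinks ($s^{-1}(v)\neq\emptyset$ for all $v\in E^0$). A finite path is a vertex (length $0$) or a sequence of edges $\alpha=\alpha_1\ldots\alpha_k$ with $r(\alpha_i)=s(\alpha_{i+1})$ for $1\le i<k$ (length $|\alpha|=k$); $\mathfrak p$ is the set of finite paths, including vertices, and $\mathfrak p^\infty$ the set of infinite paths $\gamma_1\gamma_2\ldots$ (with $r(\gamma_i)=s(\gamma_{i+1})$). One sets $r(v)=s(v)=v$ for vertices, $r(\alpha)=r(\alpha_{|\alpha|})$, $s(\alpha)=s(\alpha_1)$, $s(\gamma)\gamma=\gamma$, and $\gamma r(\gamma)=\gamma$ for finite $\gamma$. A finite path $\gamma$ is an initial segment of a path $\beta$ if $\beta=\gamma\gamma'$ for some path $\gamma'$ (so $s(\beta)$ is an initial segment of $\beta$). A vertex $v$ is an infinite emitter if $s^{-1}(v)$ is infinite. For a path $x$, $x_n$ is its $n$-th edge (defined when $n\le|x|$). The associated system. $X=\mathfrak p^\infty\cup X_{fin}$, where $X_{fin}=\{\alpha\in\mathfrak p: r(\alpha)\text{ is an infinite emitter}\}$ (vertices that are infinite emitters belong to $X_{fin}$).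 The map $\sigma$ has domain $\mathrm{Dom}(\sigma)=\{x\in X:|x|\ge1\}$ and deletes the first edge: $\sigma(\gamma_1\gamma_2\ldots)=\gamma_2\gamma_3\ldots$, $\sigma(\gamma_1\ldots\gamma_n)=\gamma_2\ldots\gamma_n$ for $n\ge2$, $\sigma(\gamma_1)=r(\gamma_1)$. Metric. Fix an enumeration $E^1=\{e_1,e_2,\ldots\}$ and an edge ordered enumeration $\mathfrak p=\{p_1,p_2,\ldots\}$, i.e. one such that for every $e_i$ the source of $e_i$ and all paths of length less than $i$ formed by edges $e_k$ with $k<i$ appear before $e_i$. For $x\ne y$ in $X$, $d(x,y)=1/2^i$ where $i$ is the smallest value such that $p_i$ is an initial segment of one of $x,y$ but not of the other; $d(x,x)=0$. Shadowing. A $\delta$-chain is an infinite sequence $(x_i)_{i=1}^\infty$ in $\mathrm{Dom}(\sigma)$ with $d(\sigma(x_i),x_{i+1})<\delta$ for all $i$. A point $x\in X$ $\varepsilon$-shadows $(y_i)_{i=1}^\infty$ if, for all $i$, $\sigma^{i-1}(x)$ is defined and $d(\sigma^{i-1}(x),y_i)<\varepsilon$. $(X,\sigma)$ has the shadowing property if for every $\varepsilon>0$ there is $\delta>0$ such that every $\delta$-chain is $\varepsilon$-shadowed by some $x\in X$. Attractor subgraph. A subgraph $E'\subset E$ is an attractor subgraph of $E$ if for all $x\in X$ there is $n\in\mathbb N$ (depending on $x$) such that $x_n\in E'^1$, where $E'^1$ is the edge set of $E'$. Eventually constrained immediate follower set property. For $e\in E^1$ let $F^1(e)=\{f\in E^1:s(f)=r(e)\}$.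 $E$ has this property if there is a natural number $k$ such that if $j>k$ and $e_\ell\in F^1(e_j)$, then $\ell\le k$. *)

theory Defs
  imports Complex_Main "HOL-Library.Stream" "HOL-Library.Extended_Nat"
    "HOL-Library.Countable_Set" "Graph_Theory.Digraph_Component"
begin

text \<open>
  A graph \<open>(E\<^sup>0, E\<^sup>1, r, s)\<close> is a \<open>wf_digraph\<close> with \<open>E\<^sup>0 = verts E\<close>, \<open>E\<^sup>1 = arcs E\<close>,
  \<open>r = head E\<close>, \<open>s = tail E\<close>. All enumerations and sequences are indexed from 1;
  their value at 0 is irrelevant.
\<close>

definition no_sinks :: "('a, 'b) pre_digraph \<Rightarrow> bool" where
  "no_sinks E \<longleftrightarrow> (\<forall>v \<in> verts E. out_arcs E v \<noteq> {})"

definition infinite_graph :: "('a, 'b) pre_digraph \<Rightarrow> bool" where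
  "infinite_graph E \<longleftrightarrow> infinite (verts E) \<or> infinite (arcs E)"

definition infinite_emitter :: "('a, 'b) pre_digraph \<Rightarrow> 'a \<Rightarrow> bool" where
  "infinite_emitter E v \<longleftrightarrow> v \<in> verts E \<and> infinite (out_arcs E v)"


section \<open>Paths\<close>

text \<open>
  \<open>Fin u es\<close> is the finite path with source \<open>u\<close> and edge sequence \<open>es\<close>; the vertex \<open>u\<close>,
  as a path of length 0, is \<open>Fin u []\<close>. On a path of positive length the recorded source is
  determined by the first edge, so the encoding is unique.
\<close>

datatype ('a, 'b) gpath = Fin 'a "'b list" | Inf "'b stream"

definition fin_paths :: "('a, 'b) pre_digraph \<Rightarrow> ('a, 'b) gpath set" where
  "fin_paths E = {Fin u es | u es. \<exists>v. pre_digraph.awalk E u es v}"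

definition inf_paths :: "('a, 'b) pre_digraph \<Rightarrow> ('a, 'b) gpath set" where
  "inf_paths E =
     {Inf g | g. \<forall>i. g !! i \<in> arcs E \<and> head E (g !! i) = tail E (g !! Suc i)}"

fun path_length :: "('a, 'b) gpath \<Rightarrow> enat" where
  "path_length (Fin u es) = enat (length es)"
| "path_length (Inf g) = \<infinity>"

fun path_edges :: "('a, 'b) gpath \<Rightarrow> 'b set" where
  "path_edges (Fin u es) = set es"
| "path_edges (Inf g) = sset g"

text \<open>The \<open>n\<close>-th edge, counted from 1; meaningful only for \<open>1 \<le> n \<le> |x|\<close>.\<close>

fun nth_edge :: "('a, 'b) gpath \<Rightarrow> nat \<Rightarrow> 'b" where
  "nth_edge (Fin u es) n = es ! (n - 1)"
| "nth_edge (Inf g) n = g !! (n - 1)"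

fun path_source :: "('a, 'b) pre_digraph \<Rightarrow> ('a, 'b) gpath \<Rightarrow> 'a" where
  "path_source E (Fin u es) = u"
| "path_source E (Inf g) = tail E (shd g)"

text \<open>\<open>Fin u es\<close> is an initial segment of \<open>b\<close> iff \<open>b\<close> is the concatenation of \<open>Fin u es\<close>
  with a path that starts where \<open>Fin u es\<close> ends.\<close>

fun path_append :: "('a, 'b) gpath \<Rightarrow> ('a, 'b) gpath \<Rightarrow> ('a, 'b) gpath" where
  "path_append (Fin u es) (Fin v fs) = Fin u (es @ fs)"
| "path_append (Fin u es) (Inf g) = Inf (es @- g)"
| "path_append (Inf g) y = Inf g"

definition initial_segment ::
    "('a, 'b) pre_digraph \<Rightarrow> ('a, 'b) gpath \<Rightarrow> ('a, 'b) gpath \<Rightarrow> bool" where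
  "initial_segment E a b \<longleftrightarrow>
     (\<exists>u es v c. a = Fin u es \<and> pre_digraph.awalk E u es v \<and>
        c \<in> fin_paths E \<union> inf_paths E \<and> path_source E c = v \<and> b = path_append a c)"


section \<open>The Deaconu-Renault system of a graph\<close>

definition X_fin :: "('a, 'b) pre_digraph \<Rightarrow> ('a, 'b) gpath set" where
  "X_fin E = {Fin u es | u es. \<exists>v. pre_digraph.awalk E u es v \<and> infinite_emitter E v}"

definition X_space :: "('a, 'b) pre_digraph \<Rightarrow> ('a, 'b) gpath set" where
  "X_space E = inf_paths E \<union> X_fin E"

definition Dom_shift :: "('a, 'b) pre_digraph \<Rightarrow> ('a, 'b) gpath set" where
  "Dom_shift E = {x \<in> X_space E. path_length x \<ge> 1}"

text \<open>Outside \<open>Dom_shift E\<close> the value is junk: every use below is guarded.\<close>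

fun shift_map :: "('a, 'b) pre_digraph \<Rightarrow> ('a, 'b) gpath \<Rightarrow> ('a, 'b) gpath" where
  "shift_map E (Fin u (e # es)) = Fin (head E e) es"
| "shift_map E (Fin u []) = Fin u []"
| "shift_map E (Inf g) = Inf (stl g)"

definition shift_iter_defined :: "('a, 'b) pre_digraph \<Rightarrow> nat \<Rightarrow> ('a, 'b) gpath \<Rightarrow> bool" where
  "shift_iter_defined E n x \<longleftrightarrow>
     x \<in> X_space E \<and> (\<forall>m < n. (shift_map E ^^ m) x \<in> Dom_shift E)"


section \<open>Enumerations and the metric\<close>

definition enumerates :: "(nat \<Rightarrow> 'c) \<Rightarrow> 'c set \<Rightarrow> bool" where
  "enumerates f A \<longleftrightarrow> bij_betw f {1..} A"

definition appears_before :: "(nat \<Rightarrow> 'c) \<Rightarrow> 'c \<Rightarrow> 'c \<Rightarrow> bool" where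
  "appears_before p a b \<longleftrightarrow> (\<exists>l m. 1 \<le> l \<and> l < m \<and> p l = a \<and> p m = b)"

text \<open>A path formed by edges has positive length: vertices are not among the paths that are
  required to precede \<open>e i\<close>, apart from the source of \<open>e i\<close>.\<close>

definition edge_ordered_enumeration ::
    "('a, 'b) pre_digraph \<Rightarrow> (nat \<Rightarrow> 'b) \<Rightarrow> (nat \<Rightarrow> ('a, 'b) gpath) \<Rightarrow> bool" where
  "edge_ordered_enumeration E e p \<longleftrightarrow>
     enumerates p (fin_paths E) \<and>
     (\<forall>i \<ge> 1.
        appears_before p (Fin (tail E (e i)) []) (Fin (tail E (e i)) [e i]) \<and>
        (\<forall>q \<in> fin_paths E.
           1 \<le> path_length q \<and> path_length q < enat i \<and> path_edges q \<subseteq> e ` {1..<i} \<longrightarrow>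
           appears_before p q (Fin (tail E (e i)) [e i])))"

definition path_dist ::
    "('a, 'b) pre_digraph \<Rightarrow> (nat \<Rightarrow> ('a, 'b) gpath) \<Rightarrow> ('a, 'b) gpath \<Rightarrow> ('a, 'b) gpath \<Rightarrow> real"
where
  "path_dist E p x y =
     (if x = y then 0
      else 1 / 2 ^ (LEAST i. 1 \<le> i \<and>
                      initial_segment E (p i) x \<noteq> initial_segment E (p i) y))"


section \<open>Shadowing\<close>

definition delta_chain ::
    "('a, 'b) pre_digraph \<Rightarrow> (nat \<Rightarrow> ('a, 'b) gpath) \<Rightarrow> real \<Rightarrow> (nat \<Rightarrow> ('a, 'b) gpath) \<Rightarrow> bool"
where
  "delta_chain E p \<delta> x \<longleftrightarrow>
     (\<forall>i \<ge> 1. x i \<in> Dom_shift E \<and> path_dist E p (shift_map E (x i)) (x (i + 1)) < \<delta>)"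

definition eps_shadows ::
    "('a, 'b) pre_digraph \<Rightarrow> (nat \<Rightarrow> ('a, 'b) gpath) \<Rightarrow> real \<Rightarrow> ('a, 'b) gpath \<Rightarrow>
     (nat \<Rightarrow> ('a, 'b) gpath) \<Rightarrow> bool"
where
  "eps_shadows E p \<epsilon> x y \<longleftrightarrow>
     (\<forall>i \<ge> 1. shift_iter_defined E (i - 1) x \<and>
               path_dist E p ((shift_map E ^^ (i - 1)) x) (y i) < \<epsilon>)"

definition shadowing_property ::
    "('a, 'b) pre_digraph \<Rightarrow> (nat \<Rightarrow> ('a, 'b) gpath) \<Rightarrow> bool" where
  "shadowing_property E p \<longleftrightarrow>
     (\<forall>\<epsilon> > 0. \<exists>\<delta> > 0. \<forall>y. delta_chain E p \<delta> y \<longrightarrow> (\<exists>x \<in> X_space E. eps_shadows E p \<epsilon> x y))"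


section \<open>Properties of the graph\<close>

text \<open>An element of \<open>X_space E\<close> of length 0 has no edges, so an attractor subgraph exists only
  if \<open>E\<close> has no infinite emitters.\<close>

definition attractor_subgraph ::
    "('a, 'b) pre_digraph \<Rightarrow> ('a, 'b) pre_digraph \<Rightarrow> bool" where
  "attractor_subgraph E' E \<longleftrightarrow>
     subgraph E' E \<and>
     (\<forall>x \<in> X_space E. \<exists>n \<ge> 1. enat n \<le> path_length x \<and> nth_edge x n \<in> arcs E')"

definition follower_set :: "('a, 'b) pre_digraph \<Rightarrow> 'b \<Rightarrow> 'b set" where
  "follower_set E e = {f \<in> arcs E. tail E f = head E e}"

definition eventually_constrained_followers ::
    "('a, 'b) pre_digraph \<Rightarrow> (nat \<Rightarrow> 'b) \<Rightarrow> bool" where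
  "eventually_constrained_followers E e \<longleftrightarrow>
     (\<exists>k \<ge> 1. \<forall>j > k. \<forall>l \<ge> 1. e l \<in> follower_set E (e j) \<longrightarrow> l \<le> k)"

end

theory Submission
  imports Defs
begin

text \<open>
  A finite attractor excludes infinite emitters, so \<open>X\<close> consists of infinite paths and every
  vertex emits finitely many edges; hence the follower condition says that a finite set \<open>A\<close> of
  edges contains every edge that has a predecessor. Given such an \<open>A\<close>, for small \<open>\<delta>\<close> the points
  \<open>\<sigma>(y\<^sub>i)\<close> and \<open>y\<^sub>i\<^sub>+\<^sub>1\<close> of a \<open>\<delta>\<close>-chain agree on long initial segments, since \<open>\<sigma>(y\<^sub>i)\<close> only uses edges
  in \<open>A\<close>, and the path formed by the first edges of the \<open>y\<^sub>i\<close> shadows the chain. Otherwise there are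
  consecutive edges \<open>f f'\<close> whose sources lie outside any prescribed finite set. A path \<open>y = f f' \<dots>\<close> then
  satisfies \<open>d(\<sigma>(y), y) < \<delta>\<close>, so the constant sequence \<open>y\<close> is a \<open>\<delta>\<close>-chain, but any point that
  shadows it closely never meets the attractor.
\<close>

section \<open>Enumerations against finite sets, and powers of 1/2\<close>

lemma enumerates_finite_subset:
  assumes "enumerates f S" "finite A" "A \<subseteq> S"
  shows "\<exists>N. A \<subseteq> f ` {1..N}"
proof -
  have "A \<subseteq> f ` {1..}"
    using assms unfolding enumerates_def bij_betw_def by auto
  then obtain I where I: "I \<subseteq> {1..}" "finite I" "A = f ` I"
    using assms(2) finite_subset_image by metis
  then have "I \<subseteq> {1..Max I}" by auto
  then show ?thesis using I by blast
qed

lemma enumerates_eventually_avoids: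
  assumes "enumerates f S" "finite B"
  shows "\<exists>k\<ge>1. \<forall>i>k. f i \<notin> B"
proof -
  have "finite (f -` B \<inter> {1..})"
    using assms unfolding enumerates_def bij_betw_def by (intro finite_vimage_IntI) auto
  then obtain k where "\<forall>i \<in> f -` B \<inter> {1..}. i \<le> k"
    using finite_nat_set_iff_bounded_le by auto
  then show ?thesis by (intro exI[of _ "Suc k"]) force
qed

lemma half_power_less: "0 < (\<epsilon>::real) \<Longrightarrow> \<exists>N. 1 / 2 ^ N < \<epsilon>"
  using real_arch_pow_inv[of \<epsilon> "1/2"] by (auto simp: power_one_over)

section \<open>Infinite paths, their initial segments and the metric on them\<close>

context wf_digraph
begin

lemma sdrop_inf_path: "Inf g \<in> inf_paths G \<Longrightarrow> Inf (sdrop n g) \<in> inf_paths G"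
  unfolding inf_paths_def by (auto simp: sdrop_snth)

lemma stl_inf_path: "Inf g \<in> inf_paths G \<Longrightarrow> Inf (stl g) \<in> inf_paths G"
  using sdrop_inf_path[of g 1] by simp

lemma awalk_stake:
  assumes "Inf g \<in> inf_paths G"
  shows "awalk (tail G (shd g)) (stake n g) (tail G (g !! n))"
  using assms
proof (induction n arbitrary: g)
  case 0
  then have "g !! 0 \<in> arcs G" unfolding inf_paths_def by blast
  then show ?case by (simp add: awalk_def)
next
  case (Suc n)
  have "Inf (stl g) \<in> inf_paths G"
    using Suc.prems by (rule stl_inf_path)
  moreover have "g !! 0 \<in> arcs G" "head G (g !! 0) = tail G (g !! Suc 0)"
    using Suc.prems unfolding inf_paths_def by blast+
  ultimately show ?case using Suc.IH[of "stl g"] by (simp add: awalk_Cons_iff)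
qed

lemma initial_segment_inf_iff:
  assumes g: "Inf g \<in> inf_paths G"
  shows "initial_segment G a (Inf g) \<longleftrightarrow> (\<exists>n. a = Fin (tail G (shd g)) (stake n g))"
proof
  assume "initial_segment G a (Inf g)"
  then obtain u es v c where a: "a = Fin u es" "awalk u es v"
    and c: "path_source G c = v" "Inf g = path_append a c"
    unfolding initial_segment_def by blast
  then obtain h where h: "c = Inf h" "g = es @- h" by (cases c) auto
  \<comment> \<open>For empty \<open>es\<close> the vertex \<open>u\<close> is fixed by
    \<open>path_source\<close> of the remainder \<open>c\<close>, otherwise by the first edge of the
    walk.\<close>
  have "u = tail G (shd g)"
    using a c h by (cases es) (auto simp: awalk_Cons_iff)
  moreover have "es = stake (length es) g"
    using h by (simp add: stake_shift)
  ultimately show "\<exists>n. a = Fin (tail G (shd g)) (stake n g)"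
    using a by blast
next
  assume "\<exists>n. a = Fin (tail G (shd g)) (stake n g)"
  then obtain n where "a = Fin (tail G (shd g)) (stake n g)" by blast
  then show "initial_segment G a (Inf g)"
    unfolding initial_segment_def using awalk_stake[OF g, of n] sdrop_inf_path[OF g, of n]
    by (intro exI[of _ "Inf (sdrop n g)"] exI conjI) (auto simp: stake_sdrop)
qed

lemma stake_in_fin_paths:
  assumes "Inf g \<in> inf_paths G"
  shows "Fin (tail G (shd g)) (stake n g) \<in> fin_paths G"
  unfolding fin_paths_def using awalk_stake[OF assms] by blast

text \<open>If the edges of two paths differ at position \<open>m\<close>, the first
  \<open>Suc m\<close> edges of one of them form an initial segment that separates the paths and is
  listed by \<open>p\<close>. So \<open>LEAST\<close> in \<open>path_dist\<close> ranges over a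
  nonempty set, and a distance below 1/2^N means that the least separating index exceeds
  \<open>N\<close>.\<close>

lemma path_dist_less_iff:
  assumes p: "enumerates p (fin_paths G)"
    and g: "Inf g \<in> inf_paths G" and h: "Inf h \<in> inf_paths G"
  shows "path_dist G p (Inf g) (Inf h) < 1 / 2 ^ N \<longleftrightarrow>
    (\<forall>i \<in> {1..N}. initial_segment G (p i) (Inf g) = initial_segment G (p i) (Inf h))"
proof (cases "g = h")
  case True
  then show ?thesis by (simp add: path_dist_def)
next
  case False
  define D where
    "D i \<longleftrightarrow> 1 \<le> i \<and> initial_segment G (p i) (Inf g) \<noteq> initial_segment G (p i) (Inf h)" for i
  obtain m where m: "g !! m \<noteq> h !! m"
    using False smap_alt[of id g h] by (auto simp: stream.map_id)
  have "stake (Suc m) g \<noteq> stake n h" for n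
  proof
    assume eq: "stake (Suc m) g = stake n h"
    then have "n = Suc m" by (metis length_stake)
    with eq have "stake (Suc m) g ! m = stake (Suc m) h ! m" by simp
    with m show False by (simp only: stake_nth lessI)
  qed
  moreover obtain i where "1 \<le> i" "p i = Fin (tail G (shd g)) (stake (Suc m) g)"
    using stake_in_fin_paths[OF g, of "Suc m"] p unfolding enumerates_def bij_betw_def
    by (metis atLeast_iff imageE)
  ultimately have "D i"
    unfolding D_def initial_segment_inf_iff[OF g] initial_segment_inf_iff[OF h]
    by (metis gpath.inject(1))
  then have least: "D (Least D)" by (rule LeastI)
  have "path_dist G p (Inf g) (Inf h) < 1 / 2 ^ N \<longleftrightarrow> N < Least D"
    using False by (simp add: path_dist_def D_def[abs_def] field_simps)
  also have "\<dots> \<longleftrightarrow> (\<forall>i \<in> {1..N}. \<not> D i)"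
  proof
    assume "N < Least D"
    then show "\<forall>i \<in> {1..N}. \<not> D i" using not_less_Least order.strict_trans1 by (metis atLeastAtMost_iff)
  next
    assume "\<forall>i \<in> {1..N}. \<not> D i"
    moreover have "1 \<le> Least D" using least unfolding D_def by blast
    ultimately show "N < Least D" using least by (meson atLeastAtMost_iff not_le)
  qed
  finally show ?thesis unfolding D_def by auto
qed

lemma shift_map_funpow_inf: "(shift_map G ^^ n) (Inf g) = Inf (sdrop n g)"
  by (induction n arbitrary: g) (auto simp: funpow_swap1)

text \<open>Without sinks every edge has a successor; iterating a choice of successors extends
  \<open>f\<close> forever.\<close>

lemma inf_path_from:
  assumes "no_sinks G" "f \<in> arcs G"
  shows "\<exists>g. shd g = f \<and> Inf g \<in> inf_paths G"
proof -
  obtain nxt where nxt: "\<And>a. a \<in> arcs G \<Longrightarrow> nxt a \<in> arcs G \<and> tail G (nxt a) = head G a"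
    using assms(1) unfolding no_sinks_def out_arcs_def by (atomize_elim, intro choice) fastforce
  have "(nxt ^^ i) f \<in> arcs G" for i
    by (induction i) (use assms nxt in auto)
  then have "Inf (siterate nxt f) \<in> inf_paths G"
    using nxt unfolding inf_paths_def by (auto simp flip: funpow_swap1)
  then show ?thesis by (intro exI[of _ "siterate nxt f"]) simp
qed

text \<open>A vertex that is an infinite emitter is a point of \<open>X\<close> without edges.\<close>

lemma attractor_imp_finite_out_arcs:
  assumes "attractor_subgraph H G"
  shows "finite (out_arcs G v)"
proof (rule ccontr)
  assume inf: "infinite (out_arcs G v)"
  then obtain f where "f \<in> out_arcs G v" using infinite_imp_nonempty by blast
  then have "v \<in> verts G" by auto
  then have "Fin v [] \<in> X_space G"
    using inf unfolding X_space_def X_fin_def infinite_emitter_def by (auto simp: awalk_Nil_iff)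
  then have "\<exists>n\<ge>1. enat n \<le> path_length (Fin v [] :: ('a, 'b) gpath)"
    using assms unfolding attractor_subgraph_def by blast
  then show False by simp
qed

end

section \<open>Graphs without infinite emitters, and the follower condition in them\<close>

locale row_finite_graph = wf_digraph +
  assumes finite_out_arcs: "finite (out_arcs G v)"
begin

lemma X_space_eq: "X_space G = inf_paths G"
  unfolding X_space_def X_fin_def infinite_emitter_def using finite_out_arcs by auto

lemma Dom_shift_eq: "Dom_shift G = inf_paths G"
  unfolding Dom_shift_def X_space_eq by (auto simp: inf_paths_def)

lemma eps_shadows_inf_iff:
  assumes "Inf x \<in> inf_paths G"
  shows "eps_shadows G p \<epsilon> (Inf x) y \<longleftrightarrow>
    (\<forall>i. path_dist G p (Inf (sdrop i x)) (y (Suc i)) < \<epsilon>)"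
proof -
  have "shift_iter_defined G i (Inf x)" for i
    unfolding shift_iter_defined_def X_space_eq Dom_shift_eq shift_map_funpow_inf
    using assms sdrop_inf_path by blast
  moreover have "(\<forall>i\<ge>1. Q i) \<longleftrightarrow> (\<forall>i. Q (Suc i))" for Q :: "nat \<Rightarrow> bool"
    by (metis One_nat_def Suc_le_D Suc_le_mono le0)
  ultimately show ?thesis
    unfolding eps_shadows_def shift_map_funpow_inf by simp
qed

text \<open>Only the first \<open>k\<close> edges can have followers of index above
  \<open>k\<close>, and by row-finiteness there are finitely many of these; adding them to the first
  \<open>k\<close> edges gives \<open>A\<close>. Conversely, any bound on the indices of edges in
  \<open>A\<close> serves as \<open>k\<close>.\<close>

lemma constrained_followers_iff:
  assumes e: "enumerates e (arcs G)"
  shows "eventually_constrained_followers G e \<longleftrightarrow>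
    (\<exists>A. finite A \<and> (\<forall>f \<in> arcs G. follower_set G f \<subseteq> A))"
proof
  assume "eventually_constrained_followers G e"
  then obtain k where k: "\<And>j l. j > k \<Longrightarrow> l \<ge> 1 \<Longrightarrow> e l \<in> follower_set G (e j) \<Longrightarrow> l \<le> k"
    unfolding eventually_constrained_followers_def by blast
  have arcs: "arcs G = e ` {1..}"
    using e unfolding enumerates_def bij_betw_def by simp
  define A where "A = e ` {1..k} \<union> (\<Union>j\<in>{1..k}. out_arcs G (head G (e j)))"
  have "finite A" unfolding A_def using finite_out_arcs by simp
  moreover have "b \<in> A" if f: "f \<in> arcs G" and b: "b \<in> follower_set G f" for f b
  proof -
    obtain j where j: "1 \<le> j" "f = e j" using f arcs by auto
    have "b \<in> arcs G" using b unfolding follower_set_def by simp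
    then obtain l where l: "1 \<le> l" "b = e l" using arcs by auto
    show ?thesis
    proof (cases "j > k")
      case True
      then show ?thesis using k j l b unfolding A_def by auto
    next
      case False
      then show ?thesis
        using j b unfolding A_def follower_set_def out_arcs_def by auto
    qed
  qed
  ultimately show "\<exists>A. finite A \<and> (\<forall>f \<in> arcs G. follower_set G f \<subseteq> A)" by blast
next
  assume "\<exists>A. finite A \<and> (\<forall>f \<in> arcs G. follower_set G f \<subseteq> A)"
  then obtain A where A: "finite A" "\<And>f. f \<in> arcs G \<Longrightarrow> follower_set G f \<subseteq> A" by blast
  obtain k where k: "k \<ge> 1" "\<And>i. i > k \<Longrightarrow> e i \<notin> A"
    using enumerates_eventually_avoids[OF e A(1)] by blast
  have "e j \<in> arcs G" if "j > k" for j
    using that e unfolding enumerates_def bij_betw_def by auto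
  then show "eventually_constrained_followers G e"
    unfolding eventually_constrained_followers_def using k A(2) by (meson not_le subsetD)
qed

text \<open>With \<open>k\<close> beyond the indices of all edges in \<open>B\<close>, failure of
  the condition at \<open>k\<close> yields consecutive edges of index above
  \<open>k\<close>.\<close>

lemma unconstrained_followers_avoid:
  assumes e: "enumerates e (arcs G)" and "\<not> eventually_constrained_followers G e" "finite B"
  shows "\<exists>f \<in> arcs G - B. \<exists>f' \<in> follower_set G f. f' \<notin> B"
proof -
  obtain k where k: "k \<ge> 1" "\<And>i. i > k \<Longrightarrow> e i \<notin> B"
    using enumerates_eventually_avoids[OF e assms(3)] by blast
  obtain j l where jl: "j > k" "e l \<in> follower_set G (e j)" "l > k"
    using assms(2) k(1) unfolding eventually_constrained_followers_def by (meson not_le)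
  then have "e j \<in> arcs G"
    using e unfolding enumerates_def bij_betw_def by auto
  then show ?thesis using jl k(2) by blast
qed

section \<open>Constrained followers imply shadowing\<close>

lemma chain_agree:
  assumes p: "enumerates p (fin_paths G)"
    and A: "finite A" "\<And>f. f \<in> arcs G \<Longrightarrow> follower_set G f \<subseteq> A"
  shows "\<exists>N. \<forall>g h. Inf g \<in> inf_paths G \<longrightarrow> Inf h \<in> inf_paths G \<longrightarrow>
    path_dist G p (Inf (stl g)) (Inf h) < 1 / 2 ^ N \<longrightarrow> stake L (stl g) = stake L h"
proof -
  \<comment> \<open>Every edge of \<open>stl g\<close> follows another edge and so lies in
    \<open>A\<close>. Its initial segment of length \<open>L\<close> is thus one of finitely many
    paths, and a single \<open>N\<close> covers the indices of all of them.\<close>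
  define P where "P = {Fin (tail G (hd s)) s | s. set s \<subseteq> A \<and> length s = L} \<inter> fin_paths G"
  have "finite {s. set s \<subseteq> A \<and> length s = L}"
    using A(1) by (rule finite_lists_length_eq)
  then have "finite P" unfolding P_def by simp
  then obtain N where N: "P \<subseteq> p ` {1..N}"
    using enumerates_finite_subset[OF p] unfolding P_def by blast
  have "stake L (stl g) = stake L h"
    if g: "Inf g \<in> inf_paths G" and h: "Inf h \<in> inf_paths G"
      and d: "path_dist G p (Inf (stl g)) (Inf h) < 1 / 2 ^ N" for g h
  \<comment> \<open>For \<open>L = 0\<close> the list is empty and its \<open>hd\<close> is
    unspecified, but the claim is trivial.\<close>
  proof (cases "L = 0")
    case False
    let ?q = "Fin (tail G (shd (stl g))) (stake L (stl g))"
    have g': "Inf (stl g) \<in> inf_paths G" using g by (rule stl_inf_path)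
    have "stl g !! m \<in> A" for m
    proof -
      have "g !! m \<in> arcs G" "g !! Suc m \<in> arcs G" "head G (g !! m) = tail G (g !! Suc m)"
        using g unfolding inf_paths_def by blast+
      then show ?thesis using A(2)[of "g !! m"] unfolding follower_set_def by auto
    qed
    then have "set (stake L (stl g)) \<subseteq> A"
      by (auto simp: in_set_conv_nth stake_nth)
    moreover have "hd (stake L (stl g)) = shd (stl g)" using False by (cases L) auto
    ultimately have "?q \<in> P"
      unfolding P_def using stake_in_fin_paths[OF g', of L] by force
    then obtain i where "i \<in> {1..N}" "p i = ?q" using N by auto
    moreover have "initial_segment G ?q (Inf (stl g))"
      using initial_segment_inf_iff[OF g'] by blast
    ultimately have "initial_segment G ?q (Inf h)"
      using d path_dist_less_iff[OF p g' h] by metis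
    then obtain n where "stake L (stl g) = stake n h"
      using initial_segment_inf_iff[OF h] by blast
    then show ?thesis by (metis length_stake)
  qed simp
  then show ?thesis by blast
qed

text \<open>The number \<open>L\<close> exceeds the length of each initial segment among
  \<open>p 1\<close>, ..., \<open>p M\<close>, so the first \<open>L\<close> edges decide which of
  these occur. As \<open>L\<close> is positive, the first edges agree, and with them the sources,
  which settles the paths of length 0.\<close>

lemma dist_less_if_stake_eq:
  assumes p: "enumerates p (fin_paths G)"
  shows "\<exists>L\<ge>1. \<forall>g h. Inf g \<in> inf_paths G \<longrightarrow> Inf h \<in> inf_paths G \<longrightarrow>
    stake L g = stake L h \<longrightarrow> path_dist G p (Inf g) (Inf h) < 1 / 2 ^ M"
proof -
  define len where "len i = the_enat (path_length (p i))" for i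
  define L where "L = Suc (\<Sum>i\<in>{1..M}. len i)"
  have transfer: "initial_segment G (p i) (Inf a)"
    if a: "Inf a \<in> inf_paths G" and b: "Inf b \<in> inf_paths G" and i: "i \<in> {1..M}"
      and eq: "stake L a = stake L b" and seg: "initial_segment G (p i) (Inf b)" for a b i
  proof -
    obtain n where n: "p i = Fin (tail G (shd b)) (stake n b)"
      using seg initial_segment_inf_iff[OF b] by blast
    then have "n = len i" by (simp add: len_def)
    also have "\<dots> \<le> L" unfolding L_def using member_le_sum[of i "{1..M}" len] i by simp
    finally have "stake n b = stake n a"
      using eq by (metis min.absorb1 take_stake)
    moreover have "shd a = shd b" using eq unfolding L_def by simp
    ultimately show ?thesis using n initial_segment_inf_iff[OF a] by auto
  qed
  have "path_dist G p (Inf g) (Inf h) < 1 / 2 ^ M"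
    if "Inf g \<in> inf_paths G" "Inf h \<in> inf_paths G" "stake L g = stake L h" for g h
    using that transfer[of g h] transfer[of h g] unfolding path_dist_less_iff[OF p that(1,2)] by metis
  then show ?thesis by (intro exI[of _ L]) (auto simp: L_def)
qed

lemma constrained_imp_shadowing:
  assumes p: "enumerates p (fin_paths G)" and e: "enumerates e (arcs G)"
    and "eventually_constrained_followers G e"
  shows "shadowing_property G p"
  unfolding shadowing_property_def
proof (intro allI impI)
  fix \<epsilon> :: real assume "\<epsilon> > 0"
  then obtain M where M: "1 / 2 ^ M < \<epsilon>" using half_power_less by blast
  obtain L where L: "L \<ge> 1" and close: "\<And>g h. Inf g \<in> inf_paths G \<Longrightarrow> Inf h \<in> inf_paths G \<Longrightarrow>
    stake L g = stake L h \<Longrightarrow> path_dist G p (Inf g) (Inf h) < 1 / 2 ^ M"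
    using dist_less_if_stake_eq[OF p] by blast
  obtain A where A: "finite A" "\<And>f. f \<in> arcs G \<Longrightarrow> follower_set G f \<subseteq> A"
    using assms(3) constrained_followers_iff[OF e] by blast
  obtain N where N: "\<And>g h. Inf g \<in> inf_paths G \<Longrightarrow> Inf h \<in> inf_paths G \<Longrightarrow>
    path_dist G p (Inf (stl g)) (Inf h) < 1 / 2 ^ N \<Longrightarrow> stake L (stl g) = stake L h"
    using chain_agree[OF p A] by blast
  have "\<exists>x \<in> X_space G. eps_shadows G p \<epsilon> x y" if y: "delta_chain G p (1 / 2 ^ N) y" for y
  proof -
    \<comment> \<open>Chains are indexed from 1 and streams from 0, hence the shift from
      \<open>y (Suc i)\<close> to \<open>g i\<close>.\<close>
    have "\<exists>g. y (Suc i) = Inf g \<and> Inf g \<in> inf_paths G" for i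
      using y unfolding delta_chain_def Dom_shift_eq by (force simp: inf_paths_def)
    then obtain g where g: "\<And>i. y (Suc i) = Inf (g i)" "\<And>i. Inf (g i) \<in> inf_paths G"
      by metis
    have "stake L (stl (g i)) = stake L (g (Suc i))" for i
      using y g(1)[of i] g(1)[of "Suc i"] unfolding delta_chain_def
      by (intro N g) (auto dest: spec[of _ "Suc i"])
    then have step: "g i !! Suc m = g (Suc i) !! m" if "m < L" for i m
      using that by (metis snth.simps(2) stake_nth)
    \<comment> \<open>Each step along the chain moves an edge one place forward, so edge
      \<open>m\<close> of \<open>g i\<close> becomes the first edge of \<open>g (i + m)\<close>, as
      long as \<open>m\<close> stays within the window of length \<open>L\<close>.\<close>
    have diag: "g i !! m = shd (g (i + m))" if "m < L" for i m
      using that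
    proof (induction m arbitrary: i)
      case (Suc m)
      then show ?case using step[of m i] Suc.IH[of "Suc i"] by simp
    qed simp
    define x where "x = smap (\<lambda>i. shd (g i)) nats"
    have x_nth: "x !! i = g i !! 0" for i by (simp add: x_def)
    have "head G (x !! i) = tail G (x !! Suc i)" "x !! i \<in> arcs G" for i
    proof -
      \<comment> \<open>Here \<open>L\<close> must be at least 1: consecutive edges of
        \<open>x\<close> are the first two edges of \<open>g i\<close>, so they are
        composable.\<close>
      have "x !! Suc i = g i !! Suc 0" using x_nth[of "Suc i"] step[of 0 i] L by (simp del: snth.simps)
      moreover have "g i !! 0 \<in> arcs G" "head G (g i !! 0) = tail G (g i !! Suc 0)"
        using g(2)[of i] unfolding inf_paths_def by blast+
      ultimately show "head G (x !! i) = tail G (x !! Suc i)" "x !! i \<in> arcs G"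
        using x_nth by metis+
    qed
    then have x: "Inf x \<in> inf_paths G" unfolding inf_paths_def by blast
    have "stake L (sdrop i x) = stake L (g i)" for i
      by (rule nth_equalityI) (auto simp: sdrop_snth x_nth diag)
    then have "path_dist G p (Inf (sdrop i x)) (y (Suc i)) < \<epsilon>" for i
      using close[OF sdrop_inf_path[OF x] g(2)] g(1) M by (metis less_trans)
    then show ?thesis using x eps_shadows_inf_iff[OF x] X_space_eq by blast
  qed
  then show "\<exists>\<delta>>0. \<forall>y. delta_chain G p \<delta> y \<longrightarrow> (\<exists>x \<in> X_space G. eps_shadows G p \<epsilon> x y)"
    by (intro exI[of _ "1 / 2 ^ N"]) simp
qed

section \<open>Shadowing implies constrained followers\<close>

lemma shadowing_imp_constrained:
  assumes p: "enumerates p (fin_paths G)" and e: "enumerates e (arcs G)"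
    and sinks: "no_sinks G" and H: "fin_digraph H" "attractor_subgraph H G"
    and shadow: "shadowing_property G p"
  shows "eventually_constrained_followers G e"
proof (rule ccontr)
  assume not_ecf: "\<not> eventually_constrained_followers G e"
  \<comment> \<open>Once the one-edge paths of \<open>H\<close> are among \<open>p 1\<close>, ...,
    \<open>p M\<close>, two infinite paths at distance below 1/2^M share their first edge whenever
    one of them starts with an edge of \<open>H\<close>.\<close>
  define Q where "Q = (\<lambda>f. Fin (tail G f) [f]) ` arcs H"
  have fin_H: "finite (arcs H)" using H(1) by (rule fin_digraph.finite_arcs)
  have H_sub: "arcs H \<subseteq> arcs G"
    using H(2) unfolding attractor_subgraph_def subgraph_def by blast
  have "Q \<subseteq> fin_paths G"
    unfolding Q_def fin_paths_def using H_sub by (blast intro: arc_implies_awalk)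
  moreover have "finite Q" unfolding Q_def using fin_H by simp
  ultimately obtain M where M: "Q \<subseteq> p ` {1..M}"
    using enumerates_finite_subset[OF p] by blast
  have "(0::real) < 1 / 2 ^ M" by simp
  then obtain \<delta> where \<delta>: "\<delta> > 0" "\<And>y. delta_chain G p \<delta> y \<Longrightarrow>
      \<exists>x \<in> X_space G. eps_shadows G p (1 / 2 ^ M) x y"
    using shadow unfolding shadowing_property_def by blast
  obtain N where N: "1 / 2 ^ N < \<delta>" using half_power_less \<delta>(1) by blast
  \<comment> \<open>An infinite path whose first edge avoids the second set starts at none of the
    sources of \<open>p 1\<close>, ..., \<open>p N\<close>, so none of these is an initial segment
    of it.\<close>
  define B where "B = arcs H \<union> (\<Union>i\<in>{1..N}. out_arcs G (path_source G (p i)))"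
  have "finite B" unfolding B_def using fin_H finite_out_arcs by simp
  then obtain f f' where f: "f \<in> arcs G" "f \<notin> B" "f' \<in> follower_set G f" "f' \<notin> B"
    using unconstrained_followers_avoid[OF e not_ecf] by blast
  have "f' \<in> arcs G" using f(3) unfolding follower_set_def by simp
  then obtain z where z: "shd z = f'" "Inf z \<in> inf_paths G"
    using inf_path_from[OF sinks] by blast
  have "(f ## z) !! i \<in> arcs G \<and> head G ((f ## z) !! i) = tail G ((f ## z) !! Suc i)" for i
    using z f(1,3) unfolding inf_paths_def follower_set_def by (cases i) auto
  then have y: "Inf (f ## z) \<in> inf_paths G" unfolding inf_paths_def by blast
  have no_seg: "\<not> initial_segment G (p i) (Inf g)"
    if "Inf g \<in> inf_paths G" "shd g \<notin> B" "i \<in> {1..N}" for g i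
  proof
    assume "initial_segment G (p i) (Inf g)"
    then have "path_source G (p i) = tail G (shd g)"
      using initial_segment_inf_iff[OF that(1)] by auto
    moreover have "shd g \<in> arcs G" using that(1) unfolding inf_paths_def by (auto dest: spec[of _ 0])
    ultimately have "shd g \<in> out_arcs G (path_source G (p i))" by simp
    then show False using that(2,3) unfolding B_def by blast
  qed
  \<comment> \<open>The path \<open>z\<close> is the shift of \<open>f ## z\<close>. The two are
    close because neither has any initial segment among \<open>p 1\<close>, ...,
    \<open>p N\<close>.\<close>
  have "path_dist G p (Inf z) (Inf (f ## z)) < 1 / 2 ^ N"
    unfolding path_dist_less_iff[OF p z(2) y] using no_seg z y f by simp
  then have "delta_chain G p \<delta> (\<lambda>_. Inf (f ## z))"
    unfolding delta_chain_def Dom_shift_eq using y N by auto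
  then obtain x' where x': "x' \<in> inf_paths G"
    and shx': "eps_shadows G p (1 / 2 ^ M) x' (\<lambda>_. Inf (f ## z))"
    using \<delta>(2) unfolding X_space_eq by blast
  from x' obtain x where "x' = Inf x" unfolding inf_paths_def by blast
  with x' shx' have x: "Inf x \<in> inf_paths G"
    and shx: "eps_shadows G p (1 / 2 ^ M) (Inf x) (\<lambda>_. Inf (f ## z))"
    by simp_all
  have "\<forall>w \<in> inf_paths G. \<exists>n\<ge>1. enat n \<le> path_length w \<and> nth_edge w n \<in> arcs H"
    using H(2) unfolding attractor_subgraph_def X_space_eq by (rule conjunct2)
  \<comment> \<open>The shadowing point meets \<open>H\<close> at position \<open>m\<close>; its
    \<open>m\<close>-th shift, being close to \<open>f ## z\<close>, would force \<open>f\<close> to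
    be an edge of \<open>H\<close>.\<close>
  from bspec[OF this x] obtain m where m: "x !! m \<in> arcs H" by auto
  have xm: "Inf (sdrop m x) \<in> inf_paths G" using sdrop_inf_path[OF x] .
  let ?q = "Fin (tail G (x !! m)) [x !! m]"
  have "?q \<in> Q" using m unfolding Q_def by auto
  then obtain i where i: "i \<in> {1..M}" "p i = ?q" using M by auto
  have "initial_segment G ?q (Inf (sdrop m x))"
    unfolding initial_segment_inf_iff[OF xm] by (intro exI[of _ 1]) simp
  moreover have close: "path_dist G p (Inf (sdrop m x)) (Inf (f ## z)) < 1 / 2 ^ M"
    using eps_shadows_inf_iff[OF x, THEN iffD1, OF shx] by (rule spec)
  ultimately have "initial_segment G ?q (Inf (f ## z))"
    using bspec[OF path_dist_less_iff[OF p xm y, THEN iffD1, OF close] i(1)] i(2) by simp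
  then obtain k where "[x !! m] = stake k (f ## z)"
    unfolding initial_segment_inf_iff[OF y] by auto
  then have "x !! m = f" by (cases k) simp_all
  then show False using m f(2) unfolding B_def by simp
qed

end

theorem proposition5p11:
  fixes E :: "('a, 'b) pre_digraph"
    and e :: "nat \<Rightarrow> 'b"
    and p :: "nat \<Rightarrow> ('a, 'b) gpath"
  assumes "wf_digraph E"
    and "countable (verts E)"
    and "countable (arcs E)"
    and "no_sinks E"
    and "infinite_graph E"
    and "enumerates e (arcs E)"
    and "edge_ordered_enumeration E e p"
    and "\<exists>E'. fin_digraph E' \<and> attractor_subgraph E' E"
  shows "shadowing_property E p \<longleftrightarrow> eventually_constrained_followers E e"
proof -
  obtain H where H: "fin_digraph H" "attractor_subgraph H E" using assms(8) by blast
  interpret row_finite_graph E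
    using assms(1) wf_digraph.attractor_imp_finite_out_arcs[OF assms(1) H(2)]
    by (intro row_finite_graph.intro row_finite_graph_axioms.intro)
  have p: "enumerates p (fin_paths E)"
    using assms(7) unfolding edge_ordered_enumeration_def by blast
  show ?thesis
    using shadowing_imp_constrained[OF p assms(6,4) H]
      constrained_imp_shadowing[OF p assms(6)] by blast
qed

end
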